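(* Let $\bar\eta\ge0$ and $n\in\mathbb{N}$. Every deterministic (respectively randomized) online algorithm for metrical task systems on the $n$-point uniform metric, with access to a prediction oracle whose prediction error is at most $\bar\eta\cdot\mathrm{OPT}$ with respect to some optimal offline algorithm, has competitive ratio $\Omega(\min\{\alpha_n,1+\bar\eta\})$, where $\alpha_n=\Theta(n)$ (respectively $\alpha_n=\Theta(\log n)$) is the optimal competitive ratio of deterministic (respectively randomized) online algorithms without predictions on this metric.
   Context: The $n$-point uniform metric is the metric space on $n$ points in which any two distinct points are at distance $1$. A metrical task system on a metric space $(M,\mathit{dist})$: starting at an initial state $x_0$, at each time $t$ a cost function $\ell_t\colon M\to\mathbb{R}_{\ge0}\cup\{+\infty\}$ arrives, the algorithm (after seeing $\ell_t$) moves to $x_t$ and pays $\mathit{dist}(x_{t-1},x_t)+\ell_t(x_t)$. With predictions, at each time $t$ the algorithm receives a predicted state $p_t$; the prediction error with respect to an offline algorithm with states $o_t$ is $\sum_t\mathit{dist}(p_t,o_t)$. $\mathrm{OPT}$ denotes the optimal offline cost. *)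

theory Defs
  imports "HOL-Analysis.Analysis" "HOL-Probability.Probability_Mass_Function"
    "HOL-Library.Landau_Symbols"
begin

section \<open>The uniform metric\<close>

definition uniform_metric :: "nat \<Rightarrow> nat metric" where
  "uniform_metric n = metric ({..<n}, discrete_metric.dd)"

lemma mspace_uniform_metric [simp]: "mspace (uniform_metric n) = {..<n}"
  by (simp add: uniform_metric_def Metric_space.mspace_metric[OF metric_M_dd])

lemma mdist_uniform_metric [simp]: "mdist (uniform_metric n) x y = (if x = y then 0 else 1)"
  unfolding uniform_metric_def Metric_space.mdist_metric[OF metric_M_dd]
  by (simp add: discrete_metric.dd_def)


section \<open>Metrical task systems\<close>

type_synonym 'a task = "'a \<Rightarrow> ennreal"

text \<open>Times are counted from 0: the \<open>t\<close>-th list entries are the task, prediction and new state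
  at time \<open>t\<close>. The state occupied just before time \<open>t\<close> is entry \<open>t\<close> of \<open>x0 # xs\<close>.\<close>

definition schedules :: "'a metric \<Rightarrow> nat \<Rightarrow> 'a list set" where
  "schedules m T = {xs. length xs = T \<and> set xs \<subseteq> mspace m}"

definition mts_cost :: "'a metric \<Rightarrow> 'a \<Rightarrow> 'a task list \<Rightarrow> 'a list \<Rightarrow> ennreal" where
  "mts_cost m x0 ls xs =
     (\<Sum>t<length ls. ennreal (mdist m ((x0 # xs) ! t) (xs ! t)) + (ls ! t) (xs ! t))"

definition opt_cost :: "'a metric \<Rightarrow> 'a \<Rightarrow> 'a task list \<Rightarrow> ennreal" where
  "opt_cost m x0 ls = (INF xs\<in>schedules m (length ls). mts_cost m x0 ls xs)"

definition optimal_schedules :: "'a metric \<Rightarrow> 'a \<Rightarrow> 'a task list \<Rightarrow> 'a list set" where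
  "optimal_schedules m x0 ls =
     {os \<in> schedules m (length ls). mts_cost m x0 ls os = opt_cost m x0 ls}"

definition prediction_error :: "'a metric \<Rightarrow> 'a list \<Rightarrow> 'a list \<Rightarrow> real" where
  "prediction_error m ps os = (\<Sum>t<length os. mdist m (ps ! t) (os ! t))"


section \<open>Online algorithms\<close>

text \<open>The type \<open>'i\<close> is the information revealed at each time: a task when there are no
  predictions, a pair of a task and a predicted state otherwise.

  A deterministic algorithm maps the initial state and the inputs revealed up to and including
  the present time to the next state.\<close>

type_synonym ('a, 'i) det_alg = "'a \<Rightarrow> 'i list \<Rightarrow> 'a"

definition det_algs :: "'a metric \<Rightarrow> ('a, 'i) det_alg set" where
  "det_algs m = {A. \<forall>x0\<in>mspace m. \<forall>is. A x0 is \<in> mspace m}"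

definition det_run :: "('a, 'i) det_alg \<Rightarrow> 'a \<Rightarrow> 'i list \<Rightarrow> 'a list" where
  "det_run A x0 is = map (\<lambda>t. A x0 (take (Suc t) is)) [0..<length is]"

text \<open>A randomized algorithm gives the distribution of its next state conditional on the initial
  state, the inputs revealed so far and the states it has itself visited so far. The inputs are
  fixed independently of its random choices (oblivious adversary).\<close>

type_synonym ('a, 'i) rand_alg = "'a \<Rightarrow> 'i list \<Rightarrow> 'a list \<Rightarrow> 'a pmf"

definition rand_algs :: "'a metric \<Rightarrow> ('a, 'i) rand_alg set" where
  "rand_algs m = {R. \<forall>x0\<in>mspace m. \<forall>is xs. set_pmf (R x0 is xs) \<subseteq> mspace m}"

primrec rand_run_upto :: "('a, 'i) rand_alg \<Rightarrow> 'a \<Rightarrow> 'i list \<Rightarrow> nat \<Rightarrow> 'a list pmf" where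
  "rand_run_upto R x0 is 0 = return_pmf []"
| "rand_run_upto R x0 is (Suc t) =
     bind_pmf (rand_run_upto R x0 is t)
       (\<lambda>xs. map_pmf (\<lambda>x. xs @ [x]) (R x0 (take (Suc t) is) xs))"

definition rand_run :: "('a, 'i) rand_alg \<Rightarrow> 'a \<Rightarrow> 'i list \<Rightarrow> 'a list pmf" where
  "rand_run R x0 is = rand_run_upto R x0 is (length is)"

definition expected_cost :: "'a metric \<Rightarrow> 'a \<Rightarrow> 'a task list \<Rightarrow> 'a list pmf \<Rightarrow> ennreal" where
  "expected_cost m x0 ls P = (\<integral>\<^sup>+ xs. mts_cost m x0 ls xs \<partial>measure_pmf P)"


section \<open>Competitive ratios\<close>

text \<open>The additive constant may depend on the algorithm and the metric, but not on the instance.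
  The ratio is infinite if the algorithm is not competitive.\<close>

definition competitive_ratio :: "'b set \<Rightarrow> ('b \<Rightarrow> ennreal) \<Rightarrow> ('b \<Rightarrow> ennreal) \<Rightarrow> ennreal" where
  "competitive_ratio I alg opt =
     Inf {r. \<exists>c::real. \<forall>i\<in>I. alg i \<le> r * opt i + ennreal c}"

definition instances :: "'a metric \<Rightarrow> ('a \<times> 'a task list) set" where
  "instances m = {(x0, ls). x0 \<in> mspace m}"

definition pred_instances :: "'a metric \<Rightarrow> real \<Rightarrow> ('a \<times> 'a task list \<times> 'a list) set" where
  "pred_instances m \<eta> =
     {(x0, ls, ps). x0 \<in> mspace m \<and> ps \<in> schedules m (length ls) \<and>
        (\<exists>os\<in>optimal_schedules m x0 ls.
           ennreal (prediction_error m ps os) \<le> ennreal \<eta> * opt_cost m x0 ls)}"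

definition det_ratio :: "'a metric \<Rightarrow> ('a, 'a task) det_alg \<Rightarrow> ennreal" where
  "det_ratio m A = competitive_ratio (instances m)
     (\<lambda>(x0, ls). mts_cost m x0 ls (det_run A x0 ls))
     (\<lambda>(x0, ls). opt_cost m x0 ls)"

definition rand_ratio :: "'a metric \<Rightarrow> ('a, 'a task) rand_alg \<Rightarrow> ennreal" where
  "rand_ratio m R = competitive_ratio (instances m)
     (\<lambda>(x0, ls). expected_cost m x0 ls (rand_run R x0 ls))
     (\<lambda>(x0, ls). opt_cost m x0 ls)"

definition det_opt_ratio :: "'a metric \<Rightarrow> ennreal" where
  "det_opt_ratio m = (INF A\<in>det_algs m. det_ratio m A)"

definition rand_opt_ratio :: "'a metric \<Rightarrow> ennreal" where
  "rand_opt_ratio m = (INF R\<in>rand_algs m. rand_ratio m R)"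

definition det_pred_ratio :: "'a metric \<Rightarrow> real \<Rightarrow> ('a, 'a task \<times> 'a) det_alg \<Rightarrow> ennreal" where
  "det_pred_ratio m \<eta> A = competitive_ratio (pred_instances m \<eta>)
     (\<lambda>(x0, ls, ps). mts_cost m x0 ls (det_run A x0 (zip ls ps)))
     (\<lambda>(x0, ls, ps). opt_cost m x0 ls)"

definition rand_pred_ratio :: "'a metric \<Rightarrow> real \<Rightarrow> ('a, 'a task \<times> 'a) rand_alg \<Rightarrow> ennreal" where
  "rand_pred_ratio m \<eta> R = competitive_ratio (pred_instances m \<eta>)
     (\<lambda>(x0, ls, ps). expected_cost m x0 ls (rand_run R x0 (zip ls ps)))
     (\<lambda>(x0, ls, ps). opt_cost m x0 ls)"

text \<open>Asymptotic notation is for real functions. Since \<^const>\<open>enn2real\<close> sends infinity to 0, a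
  \<open>\<Theta>\<close>-bound on these functions by an eventually positive function includes finiteness of the ratio
  for all large \<open>n\<close>.\<close>

definition det_alpha :: "nat \<Rightarrow> real" where
  "det_alpha n = enn2real (det_opt_ratio (uniform_metric n))"

definition rand_alpha :: "nat \<Rightarrow> real" where
  "rand_alpha n = enn2real (rand_opt_ratio (uniform_metric n))"

end

theory Submission
  imports Defs
begin

text \<open>
  Lower bounds. The adversary works in phases of \<open>k\<close> steps. It makes the cost infinite outside an
  alive set that shrinks to a single point during the phase and does not contain the survivor of
  the previous phase. Then the optimal cost is exactly 1 per phase, and any predictions at all have
  error at most \<open>k\<close> per phase, so \<open>k \<le> \<eta>\<close> suffices. Against a deterministic algorithm the adversary
  removes the current position in each step, which is possible for \<open>n - 2\<close> steps. Against a
  randomized algorithm, whose distribution is known to the adversary, it removes the half of the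
  alive set that is more likely to contain the position, which is possible for about \<open>log n\<close> steps.
  Halving the set, rather than removing random single points, keeps the error of the predictions
  proportional to the cost of the algorithm.

  Upper bounds. In a phase, each state accumulates its cost in a counter, and the algorithm leaves
  a state when its counter reaches 1. When all counters have reached 1, every schedule has paid at
  least 1 in the phase. The number of moves in a phase is at most \<open>n\<close>, and it is at most about
  \<open>harm n\<close> in expectation if the new state is chosen uniformly among the unsaturated ones.
\<close>

section \<open>Costs and runs\<close>

lemma mts_cost_Nil [simp]: "mts_cost m x [] xs = 0"
  by (simp add: mts_cost_def)

lemma mts_cost_Cons [simp]:
  "mts_cost m x (l # ls) (y # ys) = ennreal (mdist m x y) + l y + mts_cost m y ls ys"
  by (simp add: mts_cost_def sum.lessThan_Suc_shift del: sum.lessThan_Suc)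

lemma mts_cost_append:
  assumes "length xs = length ls"
  shows "mts_cost m x (ls @ ls') (xs @ ys) =
    mts_cost m x ls xs + mts_cost m (last (x # xs)) ls' ys"
  using assms by (induction xs ls arbitrary: x rule: list_induct2) (auto simp: add.assoc)

lemma rand_run_upto_append:
  "t \<le> length is \<Longrightarrow> rand_run_upto R x0 (is @ js) t = rand_run_upto R x0 is t"
  by (induction t) auto

lemma rand_run_snoc:
  "rand_run R x0 (is @ [i]) =
    rand_run R x0 is \<bind> (\<lambda>xs. map_pmf (\<lambda>x. xs @ [x]) (R x0 (is @ [i]) xs))"
  by (simp add: rand_run_def rand_run_upto_append)

lemma rand_run_Nil [simp]: "rand_run R x0 [] = return_pmf []"
  by (simp add: rand_run_def)

lemma length_rand_run: "xs \<in> set_pmf (rand_run R x0 is) \<Longrightarrow> length xs = length is"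
  by (induction "is" arbitrary: xs rule: rev_induct) (auto simp: rand_run_snoc)

lemma expected_cost_snoc:
  assumes "length is = length ls"
  shows "expected_cost m x0 (ls @ [l]) (rand_run R x0 (is @ [i])) =
    expected_cost m x0 ls (rand_run R x0 is) +
    (\<integral>\<^sup>+xs. \<integral>\<^sup>+x. ennreal (mdist m (last (x0 # xs)) x) + l x
      \<partial>R x0 (is @ [i]) xs \<partial>rand_run R x0 is)"
proof -
  have "expected_cost m x0 (ls @ [l]) (rand_run R x0 (is @ [i])) =
    (\<integral>\<^sup>+xs. \<integral>\<^sup>+x. mts_cost m x0 (ls @ [l]) (xs @ [x]) \<partial>R x0 (is @ [i]) xs \<partial>rand_run R x0 is)"
    by (simp add: expected_cost_def rand_run_snoc)
  also have "\<dots> = (\<integral>\<^sup>+xs. mts_cost m x0 ls xs + (\<integral>\<^sup>+x. ennreal (mdist m (last (x0 # xs)) x) + l x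
      \<partial>R x0 (is @ [i]) xs) \<partial>rand_run R x0 is)"
    using assms
    by (intro nn_integral_cong_AE AE_pmfI)
      (auto dest!: length_rand_run simp: mts_cost_append nn_integral_add)
  finally show ?thesis
    by (simp add: expected_cost_def nn_integral_add)
qed

lemma rand_run_map:
  "rand_run (\<lambda>x is. R x (map f is)) x0 is = rand_run R x0 (map f is)"
  by (induction "is" rule: rev_induct) (auto simp: rand_run_snoc)

text \<open>Point masses embed deterministic algorithms into randomized ones, so that the adversary
  and the phase algorithm are each treated only once.\<close>

definition rand_of_det :: "('a, 'i) det_alg \<Rightarrow> ('a, 'i) rand_alg" where
  "rand_of_det A x0 is xs = return_pmf (A x0 is)"

lemma det_run_snoc: "det_run A x0 (is @ [i]) = det_run A x0 is @ [A x0 (is @ [i])]"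
  by (simp add: det_run_def)

lemma rand_run_rand_of_det: "rand_run (rand_of_det A) x0 is = return_pmf (det_run A x0 is)"
proof (induction "is" rule: rev_induct)
  case Nil
  show ?case by (simp add: det_run_def)
next
  case (snoc i "is")
  then show ?case
    by (simp add: rand_run_snoc det_run_snoc rand_of_det_def bind_return_pmf)
qed

lemma det_ratio_eq_rand_ratio: "det_ratio m A = rand_ratio m (rand_of_det A)"
  by (simp add: det_ratio_def rand_ratio_def rand_run_rand_of_det expected_cost_def
      nn_integral_return_pmf)

lemma det_pred_ratio_eq_rand_pred_ratio:
  "det_pred_ratio m \<eta> A = rand_pred_ratio m \<eta> (rand_of_det A)"
  by (simp add: det_pred_ratio_def rand_pred_ratio_def rand_run_rand_of_det expected_cost_def
      nn_integral_return_pmf)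

text \<open>An instance with predictions is an instance with additional data, which the algorithm on
  the left discards. Lower bounds with predictions thereby carry over to the ratios without
  them.\<close>

lemma rand_pred_ratio_ignore_le:
  "rand_pred_ratio m \<eta> (\<lambda>x is. R x (map fst is)) \<le> rand_ratio m R"
  unfolding rand_pred_ratio_def rand_ratio_def competitive_ratio_def
proof (intro Inf_superset_mono Collect_mono impI, elim exE, intro exI ballI)
  fix r c i
  assume "\<forall>i\<in>instances m. (case i of (x0, ls) \<Rightarrow> expected_cost m x0 ls (rand_run R x0 ls))
    \<le> r * (case i of (x0, ls) \<Rightarrow> opt_cost m x0 ls) + ennreal c" "i \<in> pred_instances m \<eta>"
  then show "(case i of (x0, ls, ps) \<Rightarrow> expected_cost m x0 ls
      (rand_run (\<lambda>x is. R x (map fst is)) x0 (zip ls ps)))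
    \<le> r * (case i of (x0, ls, ps) \<Rightarrow> opt_cost m x0 ls) + ennreal c"
    by (auto simp: pred_instances_def instances_def schedules_def rand_run_map)
qed


section \<open>The adversary\<close>

definition barrier :: "'a set \<Rightarrow> 'a task" where
  "barrier S x = (if x \<in> S then 0 else top)"

lemma mts_cost_barrier_stay:
  "\<forall>S\<in>set ws. y \<in> S \<Longrightarrow>
    mts_cost (uniform_metric n) y (map barrier ws) (replicate (length ws) y) = 0"
  by (induction ws) (auto simp: barrier_def)

lemma mts_cost_barrier_enter_le:
  assumes "\<forall>S\<in>set ws. y \<in> S"
  shows "mts_cost (uniform_metric n) x (map barrier ws) (replicate (length ws) y) \<le> 1"
proof (cases ws)
  case (Cons W ws')
  then show ?thesis
    using assms mts_cost_barrier_stay[of ws' y n] by (auto simp: barrier_def)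
qed auto

lemma mts_cost_barrier_leave_ge:
  assumes "length xs = length ws" "ws \<noteq> []" "x \<notin> hd ws"
  shows "1 \<le> mts_cost (uniform_metric n) x (map barrier ws) xs"
proof -
  obtain W ws' y ys where [simp]: "ws = W # ws'" "xs = y # ys"
    using assms by (cases ws; cases xs) auto
  show ?thesis
    using assms by (auto simp: barrier_def)
qed

lemma last_in_barrier:
  assumes "length xs = length ws" "ws \<noteq> []"
    and "mts_cost (uniform_metric n) x (map barrier ws) xs < top"
  shows "last xs \<in> last ws"
  using assms
proof (induction xs ws arbitrary: x rule: list_induct2)
  case (Cons y ys W ws)
  then show ?case
    by (cases "ws = []") (auto simp: barrier_def ennreal_add_less_top split: if_splits)
qed auto

text \<open>From a position outside \<open>S\<close>, the new step costs at least 1 wherever it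
  leads: staying costs infinity, and any move costs 1.\<close>

lemma expected_cost_barrier_ge:
  assumes "length is = length ls"
  shows "expected_cost (uniform_metric n) x0 ls (rand_run R x0 is) +
      ennreal (measure_pmf.prob (rand_run R x0 is) {xs. last (x0 # xs) \<notin> S})
    \<le> expected_cost (uniform_metric n) x0 (ls @ [barrier S]) (rand_run R x0 (is @ [i]))"
proof -
  have "ennreal (measure_pmf.prob (rand_run R x0 is) {xs. last (x0 # xs) \<notin> S}) =
      (\<integral>\<^sup>+xs. indicator {xs. last (x0 # xs) \<notin> S} xs \<partial>rand_run R x0 is)"
    by (simp add: measure_pmf.emeasure_eq_measure)
  also have "\<dots> \<le> (\<integral>\<^sup>+xs. \<integral>\<^sup>+x. ennreal (mdist (uniform_metric n) (last (x0 # xs)) x) + barrier S x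
      \<partial>R x0 (is @ [i]) xs \<partial>rand_run R x0 is)"
  proof (rule nn_integral_mono)
    fix xs
    have "indicator {xs. last (x0 # xs) \<notin> S} xs =
        (\<integral>\<^sup>+x. indicator {xs. last (x0 # xs) \<notin> S} xs \<partial>R x0 (is @ [i]) xs)"
      by simp
    also have "\<dots> \<le> (\<integral>\<^sup>+x. ennreal (mdist (uniform_metric n) (last (x0 # xs)) x) + barrier S x
        \<partial>R x0 (is @ [i]) xs)"
      by (rule nn_integral_mono) (auto simp: barrier_def indicator_def)
    finally show "indicator {xs. last (x0 # xs) \<notin> S} xs \<le> \<dots>" .
  qed
  finally show ?thesis
    unfolding expected_cost_snoc[OF assms] by (rule add_left_mono)
qed

text \<open>\<open>F k\<close> is the size of the alive set when \<open>k\<close> steps of a phase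
  remain, and \<open>\<delta>\<close> is the cost forced in each step. In \<open>narrow\<close>, the
  choice may depend on \<open>is\<close> because the adversary can compute the law of the algorithm
  after any inputs.\<close>

locale adversary =
  fixes n :: nat and R :: "(nat, nat task \<times> nat) rand_alg" and x0 :: nat
    and F :: "nat \<Rightarrow> nat" and \<delta> :: real
  assumes x0: "x0 < n" and \<delta>: "\<delta> \<ge> 0" and F_0: "F 0 = 1"
    and narrow: "\<And>is k S. card S = F (Suc k) \<Longrightarrow>
      \<exists>S'\<subseteq>S. card S' = F k \<and>
        \<delta> \<le> measure_pmf.prob (rand_run R x0 is) {xs. last (x0 # xs) \<notin> S'}"
begin

text \<open>All predictions are \<open>x0\<close>: they tell the algorithm nothing, and on the
  uniform metric their error is at most 1 per step.\<close>

definition alg_cost :: "nat set list \<Rightarrow> ennreal" where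
  "alg_cost zs = expected_cost (uniform_metric n) x0 (map barrier zs)
     (rand_run R x0 (map (\<lambda>S. (barrier S, x0)) zs))"

text \<open>Each narrowing adds at least \<open>\<delta>\<close> to the expected cost. The history
  \<open>zs\<close> is arbitrary because the law of the algorithm depends on all past tasks;
  \<open>S0\<close> is the alive set before the first narrowing.\<close>

lemma phase:
  assumes "card S0 = F k"
  shows "\<exists>ws s. length ws = k \<and> (\<forall>S\<in>set ws. s \<in> S \<and> S \<subseteq> S0) \<and> last (S0 # ws) = {s} \<and>
    alg_cost zs + ennreal (\<delta> * k) \<le> alg_cost (zs @ ws)"
  using assms
proof (induction k arbitrary: S0 zs)
  case 0
  then obtain s where "S0 = {s}"
    using F_0 by (metis card_1_singletonE)
  then show ?case by (intro exI[of _ "[]"]) auto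
next
  case (Suc k)
  define P where "P = rand_run R x0 (map (\<lambda>S. (barrier S, x0)) zs)"
  obtain S1 where S1: "S1 \<subseteq> S0" "card S1 = F k"
      "\<delta> \<le> measure_pmf.prob P {xs. last (x0 # xs) \<notin> S1}"
    using narrow[OF Suc.prems] unfolding P_def by blast
  obtain ws s where ws: "length ws = k" "\<forall>S\<in>set ws. s \<in> S \<and> S \<subseteq> S1" "last (S1 # ws) = {s}"
      "alg_cost (zs @ [S1]) + ennreal (\<delta> * k) \<le> alg_cost ((zs @ [S1]) @ ws)"
    using Suc.IH[OF S1(2)] by blast
  have "s \<in> S1"
    using ws(2,3) by (cases ws) auto
  have "alg_cost zs + ennreal \<delta> \<le>
      alg_cost zs + ennreal (measure_pmf.prob P {xs. last (x0 # xs) \<notin> S1})"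
    using S1(3) by (intro add_left_mono ennreal_leI)
  also have "\<dots> \<le> alg_cost (zs @ [S1])"
    using expected_cost_barrier_ge[of "map (\<lambda>S. (barrier S, x0)) zs" "map barrier zs" n x0 R S1]
    by (simp add: alg_cost_def P_def)
  finally have "alg_cost zs + ennreal \<delta> + ennreal (\<delta> * k) \<le> alg_cost (zs @ [S1]) + ennreal (\<delta> * k)"
    by (rule add_right_mono)
  with ws(4) have "alg_cost zs + ennreal (\<delta> * Suc k) \<le> alg_cost (zs @ S1 # ws)"
    using \<delta> by (simp add: distrib_left add.assoc ennreal_plus[symmetric] del: ennreal_plus)
  then show ?case
    using ws \<open>s \<in> S1\<close> S1(1) by (intro exI[of _ "S1 # ws"] exI[of _ s]) auto
qed

text \<open>As the survivor of a phase is forbidden at the start of the next one, every schedule of finite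
  cost moves in each phase, and moving once is enough.\<close>

lemma phases:
  assumes k: "k \<ge> 1" and Fk: "F k < n"
  shows "\<exists>zs s os. length zs = N * k \<and> s < n \<and> os \<in> schedules (uniform_metric n) (N * k) \<and>
    last (x0 # os) = s \<and>
    mts_cost (uniform_metric n) x0 (map barrier zs) os \<le> of_nat N \<and>
    (\<forall>xs. length xs = N * k \<longrightarrow>
       of_nat N \<le> mts_cost (uniform_metric n) x0 (map barrier zs) xs \<and>
       (mts_cost (uniform_metric n) x0 (map barrier zs) xs < top \<longrightarrow> last (x0 # xs) = s)) \<and>
    ennreal (\<delta> * k * N) \<le> alg_cost zs"
proof (induction N)
  case 0
  show ?case
    using x0 by (intro exI[of _ "[]"] exI[of _ x0]) (auto simp: schedules_def)
next
  case (Suc N)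
  let ?c = "\<lambda>x zs. mts_cost (uniform_metric n) x (map barrier zs)"
  obtain zs s os where zs: "length zs = N * k" "s < n"
    and os: "os \<in> schedules (uniform_metric n) (N * k)" "last (x0 # os) = s"
      "?c x0 zs os \<le> of_nat N"
    and opt: "\<And>xs. length xs = N * k \<Longrightarrow> of_nat N \<le> ?c x0 zs xs"
      "\<And>xs. length xs = N * k \<Longrightarrow> ?c x0 zs xs < top \<Longrightarrow> last (x0 # xs) = s"
    and alg: "ennreal (\<delta> * k * N) \<le> alg_cost zs"
    using Suc.IH by blast
  \<comment> \<open>As \<open>F k < n\<close>, the new alive set can avoid the old survivor
    \<open>s\<close>.\<close>
  have "F k \<le> card ({..<n} - {s})"
    using zs(2) Fk by simp
  then obtain S0 where S0: "S0 \<subseteq> {..<n} - {s}" "card S0 = F k"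
    by (meson obtain_subset_with_card_n)
  obtain ws s' where ws: "length ws = k" "\<forall>S\<in>set ws. s' \<in> S \<and> S \<subseteq> S0" "last (S0 # ws) = {s'}"
      "alg_cost zs + ennreal (\<delta> * k) \<le> alg_cost (zs @ ws)"
    using phase[OF S0(2)] by blast
  have [simp]: "ws \<noteq> []"
    using ws(1) k by auto
  have hd: "s' \<in> hd ws" "hd ws \<subseteq> S0"
    using ws(2) by auto
  then have s': "s' < n" and s: "s \<notin> hd ws"
    using S0(1) by auto
  have last_ws: "last ws = {s'}"
    using ws(3) by simp
  have len_os: "length os = N * k"
    using os(1) by (simp add: schedules_def)
  have "?c x0 (zs @ ws) (os @ replicate k s') \<le> of_nat N + 1"
    using os(2,3) mts_cost_barrier_enter_le[of ws s' n s] ws(1,2) zs(1) len_os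
    by (simp add: mts_cost_append add_mono del: last.simps)
  moreover have "of_nat (Suc N) \<le> ?c x0 (zs @ ws) xs \<and>
      (?c x0 (zs @ ws) xs < top \<longrightarrow> last (x0 # xs) = s')" if "length xs = Suc N * k" for xs
  proof -
    define ys us where "ys = take (N * k) xs" and "us = drop (N * k) xs"
    have xs: "xs = ys @ us" and len: "length ys = N * k" "length us = k"
      using that by (auto simp: ys_def us_def)
    have c: "?c x0 (zs @ ws) xs = ?c x0 zs ys + ?c (last (x0 # ys)) ws us"
      using len zs(1) by (simp add: xs mts_cost_append)
    show ?thesis
    proof (cases "?c x0 (zs @ ws) xs < top")
      case True
      then have fin: "?c x0 zs ys < top" "?c (last (x0 # ys)) ws us < top"
        unfolding c by (simp_all only: ennreal_add_less_top)
      then have "last (x0 # ys) = s"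
        using opt(2) len by blast
      then have "1 \<le> ?c (last (x0 # ys)) ws us"
        using s len ws(1) by (intro mts_cost_barrier_leave_ge) auto
      moreover have "last us = s'"
        using last_in_barrier[OF _ _ fin(2)] len ws(1) last_ws by auto
      moreover have "us \<noteq> []"
        using len k by auto
      ultimately show ?thesis
        using add_mono[OF opt(1)[OF len(1)], of 1 "?c (last (x0 # ys)) ws us"] unfolding c
        by (auto simp: xs add.commute)
    qed (auto simp: less_top[symmetric])
  qed
  moreover have "ennreal (\<delta> * k * Suc N) \<le> alg_cost (zs @ ws)"
  proof -
    have "ennreal (\<delta> * k * Suc N) = ennreal (\<delta> * k * N) + ennreal (\<delta> * k)"
      using \<delta> by (simp add: distrib_left ennreal_plus[symmetric] del: ennreal_plus)
    also have "\<dots> \<le> alg_cost zs + ennreal (\<delta> * k)"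
      using alg by (rule add_right_mono)
    finally show ?thesis
      using ws(4) by simp
  qed
  moreover have "os @ replicate k s' \<in> schedules (uniform_metric n) (Suc N * k)"
    using os(1) s' by (auto simp: schedules_def)
  moreover have "last (x0 # os @ replicate k s') = s'"
    using k by auto
  ultimately show ?case
    using s' zs(1) ws(1)
    by (intro exI[of _ "zs @ ws"] exI[of _ s'] exI[of _ "os @ replicate k s'"])
      (auto simp: add.commute)
qed

text \<open>Over \<open>N\<close> phases the offline cost is exactly \<open>N\<close>, the algorithm
  pays at least \<open>\<delta> * k * N\<close>, and the error is at most \<open>N * k\<close>,
  hence within the allowed \<open>\<eta> * N\<close>. Letting \<open>N\<close> grow removes the
  additive constant.\<close>

lemma rand_pred_ratio_ge:
  assumes k: "k \<ge> 1" and Fk: "F k < n" and \<eta>: "real k \<le> \<eta>"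
  shows "ennreal (\<delta> * k) \<le> rand_pred_ratio (uniform_metric n) \<eta> R"
  unfolding rand_pred_ratio_def competitive_ratio_def
proof (rule Inf_greatest, safe)
  fix r c
  assume *: "\<forall>i\<in>pred_instances (uniform_metric n) \<eta>.
    (case i of (x0, ls, ps) \<Rightarrow> expected_cost (uniform_metric n) x0 ls (rand_run R x0 (zip ls ps)))
    \<le> r * (case i of (x0, ls, ps) \<Rightarrow> opt_cost (uniform_metric n) x0 ls) + ennreal c"
  have bound: "ennreal (\<delta> * k * N) \<le> r * of_nat N + ennreal c" for N
  proof -
    obtain zs s os where zs: "length zs = N * k"
      and os: "os \<in> schedules (uniform_metric n) (N * k)"
        "mts_cost (uniform_metric n) x0 (map barrier zs) os \<le> of_nat N"
      and opt: "\<And>xs. length xs = N * k \<Longrightarrow>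
        of_nat N \<le> mts_cost (uniform_metric n) x0 (map barrier zs) xs"
      and alg: "ennreal (\<delta> * k * N) \<le> alg_cost zs"
      using phases[OF k Fk, of N] by blast
    have opt_cost: "opt_cost (uniform_metric n) x0 (map barrier zs) = of_nat N"
      unfolding opt_cost_def
    proof (rule antisym)
      show "(INF xs\<in>schedules (uniform_metric n) (length (map barrier zs)).
          mts_cost (uniform_metric n) x0 (map barrier zs) xs) \<le> of_nat N"
        using os zs by (intro INF_lower2[of os]) auto
    qed (use opt zs in \<open>auto intro!: INF_greatest simp: schedules_def\<close>)
    have len_os: "length os = N * k"
      using os(1) by (simp add: schedules_def)
    have "mts_cost (uniform_metric n) x0 (map barrier zs) os = of_nat N"
      using os(2) opt[OF len_os] by (rule antisym)
    then have optimal: "os \<in> optimal_schedules (uniform_metric n) x0 (map barrier zs)"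
      using os(1) zs opt_cost by (simp add: optimal_schedules_def)
    let ?ps = "replicate (N * k) x0"
    have "prediction_error (uniform_metric n) ?ps os \<le> (\<Sum>t<length os. 1)"
      unfolding prediction_error_def by (rule sum_mono) simp
    also have "\<dots> \<le> \<eta> * N"
      using mult_right_mono[OF \<eta>, of "real N"] by (simp add: len_os mult.commute)
    finally have "ennreal (prediction_error (uniform_metric n) ?ps os) \<le> ennreal \<eta> * of_nat N"
      using \<eta> k by (simp add: ennreal_of_nat_eq_real_of_nat ennreal_mult[symmetric] ennreal_leI)
    then have "(x0, map barrier zs, ?ps) \<in> pred_instances (uniform_metric n) \<eta>"
      using optimal x0 zs opt_cost by (auto simp: pred_instances_def schedules_def)
    moreover have "zip (map barrier zs) ?ps = map (\<lambda>S. (barrier S, x0)) zs"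
      using zs by (auto intro!: nth_equalityI)
    ultimately show ?thesis
      using * alg opt_cost unfolding alg_cost_def by fastforce
  qed
  show "ennreal (\<delta> * k) \<le> r"
  proof (cases r)
    case (real q)
    \<comment> \<open>Since \<open>ennreal c\<close> is 0 for negative \<open>c\<close>,
      \<open>max c 0\<close> takes its place on passing to real numbers.\<close>
    have "\<delta> * k * N \<le> q * N + max c 0" for N :: nat
    proof -
      have "ennreal (\<delta> * k * N) \<le> r * of_nat N + ennreal (max c 0)"
        using bound[of N] by (rule order_trans) (auto intro!: add_left_mono ennreal_leI)
      also have "\<dots> = ennreal (q * N + max c 0)"
        using real by (simp add: ennreal_of_nat_eq_real_of_nat ennreal_mult)
      finally have "ennreal (\<delta> * k * N) \<le> \<dots>" .
      then show ?thesis
        using real by (subst (asm) ennreal_le_iff) auto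
    qed
    then have *: "(\<delta> * k - q) * N \<le> max c 0" for N :: nat
      by (simp add: algebra_simps)
    have "\<delta> * k \<le> q"
    proof (rule ccontr)
      assume "\<not> \<delta> * k \<le> q"
      then obtain N :: nat where "max c 0 < N * (\<delta> * k - q)"
        using reals_Archimedean3[of "\<delta> * k - q"] by (meson diff_gt_0_iff_gt not_le)
      with *[of N] show False by (simp add: mult.commute)
    qed
    then show ?thesis
      using real by (simp add: ennreal_leI)
  qed simp
qed

end

section \<open>Phase algorithms\<close>

text \<open>A phase is over once all counters are at least 1. The counters are then kept until the next
  task, so that the absence of unsaturated states marks the start of a new phase; the initial
  value 1 makes this hold at time 0 as well.\<close>

definition counters :: "nat \<Rightarrow> nat task list \<Rightarrow> nat \<Rightarrow> ennreal" where
  "counters n = foldl (\<lambda>c l. if \<exists>x<n. c x < 1 then (\<lambda>x. c x + l x) else l) (\<lambda>_. 1)"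

definition unsat :: "nat \<Rightarrow> nat task list \<Rightarrow> nat set" where
  "unsat n ls = {x. x < n \<and> counters n ls x < 1}"

lemma unsat_Nil [simp]: "unsat n [] = {}"
  by (simp add: unsat_def counters_def)

lemma finite_unsat [simp]: "finite (unsat n ls)"
  by (simp add: unsat_def)

lemma unsat_subset: "unsat n ls \<subseteq> {..<n}"
  by (auto simp: unsat_def)

lemma card_unsat_le: "card (unsat n ls) \<le> n"
  using card_mono[OF _ unsat_subset] by fastforce

lemma counters_snoc:
  "counters n (ls @ [l]) x = (if unsat n ls = {} then l x else counters n ls x + l x)"
  by (auto simp: counters_def unsat_def)

lemma unsat_snoc_subset: "unsat n ls \<noteq> {} \<Longrightarrow> unsat n (ls @ [l]) \<subseteq> unsat n ls"
  by (auto simp: unsat_def[of n "ls @ [l]"] counters_snoc)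
    (auto simp: unsat_def intro: le_less_trans[rotated])

section \<open>Phases and the offline cost\<close>

definition cheapest :: "nat \<Rightarrow> nat task \<Rightarrow> nat" where
  "cheapest n l = arg_min_on l {..<n}"

lemma cheapest_less: "n \<ge> 1 \<Longrightarrow> cheapest n l < n"
  using arg_min_if_finite(1)[of "{..<n}" l] by (auto simp: cheapest_def lessThan_empty_iff)

lemma cheapest_le: "x < n \<Longrightarrow> l (cheapest n l) \<le> l x"
  unfolding cheapest_def by (rule arg_min_least) auto

text \<open>Every time without unsaturated states ends a phase of its own, since the next task
  already starts a new one. The sum thus counts completed phases.\<close>

definition phase_count :: "nat \<Rightarrow> nat task list \<Rightarrow> ennreal" where
  "phase_count n ls = (\<Sum>t<length ls. if unsat n (take (Suc t) ls) = {} then 1 else 0)"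

definition reset_cost :: "nat \<Rightarrow> nat task list \<Rightarrow> ennreal" where
  "reset_cost n ls =
    (\<Sum>t<length ls. if unsat n (take (Suc t) ls) = {} then (ls ! t) (cheapest n (ls ! t)) else 0)"

lemma phase_count_Nil [simp]: "phase_count n [] = 0"
  by (simp add: phase_count_def)

lemma reset_cost_Nil [simp]: "reset_cost n [] = 0"
  by (simp add: reset_cost_def)

lemma phase_count_snoc:
  "phase_count n (ls @ [l]) = phase_count n ls + (if unsat n (ls @ [l]) = {} then 1 else 0)"
  by (simp add: phase_count_def)

lemma reset_cost_snoc:
  "reset_cost n (ls @ [l]) =
    reset_cost n ls + (if unsat n (ls @ [l]) = {} then l (cheapest n l) else 0)"
proof -
  have "(\<Sum>t<length ls. if unsat n (take (Suc t) (ls @ [l])) = {}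
      then ((ls @ [l]) ! t) (cheapest n ((ls @ [l]) ! t)) else 0) = reset_cost n ls"
    unfolding reset_cost_def by (intro sum.cong refl) (simp add: nth_append)
  then show ?thesis
    by (simp add: reset_cost_def[of n "ls @ [l]"])
qed

text \<open>Within a phase a schedule either has moved, at cost 1, or has stayed and paid the
  counter of its state. Either way it has paid at least the capped counter of its current
  state.\<close>

lemma phase_count_le_cost:
  assumes "length xs = length ls" "set xs \<subseteq> {..<n}"
  shows "phase_count n ls +
      (if unsat n ls = {} then 0 else min 1 (counters n ls (last (x0 # xs))))
    \<le> mts_cost (uniform_metric n) x0 ls xs"
  using assms
proof (induction ls arbitrary: xs rule: rev_induct)
  case (snoc l ls)
  then obtain ys y where xs: "xs = ys @ [y]" and len: "length ys = length ls"
    by (cases xs rule: rev_cases) auto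
  have y: "y < n" and ys: "set ys \<subseteq> {..<n}"
    using snoc.prems(2) by (auto simp: xs)
  define a where "a = last (x0 # ys)"
  define pot where "pot = (if unsat n ls = {} then 0 else min 1 (counters n ls a))"
  define d where "d = ennreal (mdist (uniform_metric n) a y)"
  have IH: "phase_count n ls + pot \<le> mts_cost (uniform_metric n) x0 ls ys"
    using snoc.IH[OF len ys] by (simp only: pot_def a_def)
  \<comment> \<open>At the end of a phase every capped counter equals 1 and turns into the new unit
    of \<open>phase_count\<close>, so one inequality covers both cases.\<close>
  have sat: "min 1 (counters n (ls @ [l]) y) = 1" if "unsat n (ls @ [l]) = {}"
    using that y by (auto simp: unsat_def min_def)
  have "phase_count n (ls @ [l]) +
      (if unsat n (ls @ [l]) = {} then 0 else min 1 (counters n (ls @ [l]) (last (x0 # xs)))) =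
      phase_count n ls + min 1 (counters n (ls @ [l]) y)"
    by (auto simp: phase_count_snoc xs sat)
  also have "min 1 (counters n (ls @ [l]) y) \<le> pot + (d + l y)"
  proof (cases "a = y")
    case True
    have "min 1 (c + l y) \<le> min 1 c + l y" for c
      by (auto simp: min_def intro: order_trans[of _ c] add_increasing2)
    then show ?thesis
      using True by (auto simp: pot_def d_def counters_snoc)
  next
    case False
    then have "1 \<le> pot + (d + l y)"
      by (auto simp: d_def intro!: add_increasing add_increasing2)
    then show ?thesis
      by (rule min.coboundedI1)
  qed
  also have "phase_count n ls + (pot + (d + l y)) \<le> mts_cost (uniform_metric n) x0 (ls @ [l]) xs"
    using add_right_mono[OF IH, of "d + l y"]
    by (simp add: xs mts_cost_append len add.assoc d_def a_def)
  finally show ?case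
    by (meson add_left_mono order_trans)
qed simp

lemma reset_cost_le_cost:
  assumes "length xs = length ls" "set xs \<subseteq> {..<n}"
  shows "reset_cost n ls \<le> mts_cost (uniform_metric n) x0 ls xs"
  unfolding reset_cost_def mts_cost_def
proof (rule sum_mono)
  fix t assume "t \<in> {..<length ls}"
  then have "xs ! t < n"
    using assms by (metis lessThan_iff nth_mem subsetD)
  then show "(if unsat n (take (Suc t) ls) = {} then (ls ! t) (cheapest n (ls ! t)) else 0)
      \<le> ennreal (mdist (uniform_metric n) ((x0 # xs) ! t) (xs ! t)) + (ls ! t) (xs ! t)"
    by (auto intro!: add_increasing cheapest_le)
qed

text \<open>The state during a phase has law \<open>D U\<close>, where \<open>U\<close> is the set of unsaturated states. It is
  only resampled when it becomes saturated, and \<open>D_refine\<close> says that this preserves the form of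
  the law. When a phase ends, the algorithm moves to the state that is cheapest for the current
  task, and the offline cost at this time is at least as large.\<close>

locale phase_algorithm =
  fixes n :: nat and D :: "nat set \<Rightarrow> nat pmf" and h :: "nat \<Rightarrow> real"
    and R :: "(nat, nat task) rand_alg"
  assumes n: "n \<ge> 1"
    and D_subset: "\<And>U. \<lbrakk>U \<noteq> {}; U \<subseteq> {..<n}\<rbrakk> \<Longrightarrow> set_pmf (D U) \<subseteq> U"
    and D_refine: "\<And>U U'. \<lbrakk>U' \<noteq> {}; U' \<subseteq> U; U \<subseteq> {..<n}\<rbrakk> \<Longrightarrow>
      D U \<bind> (\<lambda>x. if x \<in> U' then return_pmf x else D U') = D U'"
    and D_leave: "\<And>U U'. \<lbrakk>U' \<noteq> {}; U' \<subseteq> U; U \<subseteq> {..<n}\<rbrakk> \<Longrightarrow>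
      measure_pmf.prob (D U) (- U') \<le> h (card U) - h (card U')"
    and h_mono: "mono h" and h_0: "h 0 \<ge> 0"
    and R_reset: "\<And>x0 ls l xs. unsat n (ls @ [l]) = {} \<Longrightarrow>
      R x0 (ls @ [l]) xs = return_pmf (cheapest n l)"
    and R_start: "\<And>x0 ls l xs. \<lbrakk>unsat n (ls @ [l]) \<noteq> {}; unsat n ls = {}\<rbrakk> \<Longrightarrow>
      R x0 (ls @ [l]) xs = D (unsat n (ls @ [l]))"
    and R_move: "\<And>x0 ls l xs. \<lbrakk>unsat n (ls @ [l]) \<noteq> {}; unsat n ls \<noteq> {};
        last (x0 # xs) \<in> set_pmf (D (unsat n ls))\<rbrakk> \<Longrightarrow>
      R x0 (ls @ [l]) xs = (if last (x0 # xs) \<in> unsat n (ls @ [l]) then return_pmf (last (x0 # xs))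
        else D (unsat n (ls @ [l])))"
begin

lemma h_nonneg: "h k \<ge> 0"
  using h_0 monoD[OF h_mono, of 0 k] by simp

text \<open>Resampling only upon saturation is exactly the kernel of \<open>D_refine\<close>, so the
  law depends on the past only through the unsaturated set.\<close>

lemma law_last:
  assumes "unsat n ls \<noteq> {}"
  shows "map_pmf (\<lambda>xs. last (x0 # xs)) (rand_run R x0 ls) = D (unsat n ls)"
  using assms
proof (induction ls rule: rev_induct)
  case (snoc l ls)
  let ?U = "unsat n ls" and ?U' = "unsat n (ls @ [l])"
  have *: "map_pmf (\<lambda>xs. last (x0 # xs)) (rand_run R x0 (ls @ [l])) =
      rand_run R x0 ls \<bind> (\<lambda>xs. R x0 (ls @ [l]) xs)"
    by (simp add: rand_run_snoc map_bind_pmf map_pmf_comp)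
  show ?case
  proof (cases "?U = {}")
    case True
    then show ?thesis
      unfolding * R_start[OF snoc.prems True] by simp
  next
    case False
    note law = snoc.IH[OF False]
    have "rand_run R x0 ls \<bind> (\<lambda>xs. R x0 (ls @ [l]) xs) =
        rand_run R x0 ls \<bind>
          (\<lambda>xs. (\<lambda>x. if x \<in> ?U' then return_pmf x else D ?U') (last (x0 # xs)))"
    proof (rule bind_pmf_cong[OF refl])
      fix xs assume "xs \<in> set_pmf (rand_run R x0 ls)"
      then have "last (x0 # xs) \<in> set_pmf (D ?U)"
        unfolding law[symmetric] by auto
      then show "R x0 (ls @ [l]) xs =
          (\<lambda>x. if x \<in> ?U' then return_pmf x else D ?U') (last (x0 # xs))"
        using R_move[OF snoc.prems False] by blast
    qed
    also have "\<dots> = D ?U \<bind> (\<lambda>x. if x \<in> ?U' then return_pmf x else D ?U')"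
      unfolding law[symmetric] bind_map_pmf ..
    also have "\<dots> = D ?U'"
      using snoc.prems False by (intro D_refine unsat_snoc_subset unsat_subset)
    finally show ?thesis
      unfolding * .
  qed
qed simp

text \<open>A bound for the expected cost of the running phase. The integral is the expected counter
  of the current state, and the 1 pays for the first move. By \<open>D_leave\<close> the resampling
  probabilities telescope to at most the difference of the \<open>h\<close>-values. The factor 2
  arises because a resampling pays for a move and also abandons a state whose counter, at most 1,
  drops out of the integral.\<close>

definition potential :: "nat task list \<Rightarrow> ennreal" where
  "potential ls = (if unsat n ls = {} then 0 else
     (\<integral>\<^sup>+x. counters n ls x \<partial>D (unsat n ls)) + ennreal (1 + 2 * (h n - h (card (unsat n ls)))))"

text \<open>The integral is at most 1, as counters are below 1 on the support of \<open>D\<close>.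
  The additional 1 is the move that ends the phase.\<close>

lemma potential_le: "potential ls + 1 \<le> ennreal (3 + 2 * h n)"
proof (cases "unsat n ls = {}")
  case True
  then show ?thesis
    using ennreal_leI[of 1 "3 + 2 * h n"] h_nonneg[of n] by (simp add: potential_def)
next
  case False
  then have "(\<integral>\<^sup>+x. counters n ls x \<partial>D (unsat n ls)) \<le> (\<integral>\<^sup>+x. 1 \<partial>D (unsat n ls))"
    using D_subset[OF False unsat_subset]
    by (intro nn_integral_mono_AE AE_pmfI) (auto simp: unsat_def)
  then have "(\<integral>\<^sup>+x. counters n ls x \<partial>D (unsat n ls)) \<le> 1"
    by simp
  then have "potential ls + 1 \<le> 1 + ennreal (1 + 2 * (h n - h (card (unsat n ls)))) + 1"
    unfolding potential_def using False by (simp only: if_False add_right_mono)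
  also have "\<dots> = ennreal (1 + (1 + 2 * (h n - h (card (unsat n ls)))) + 1)"
  proof -
    have "1 + ennreal a + 1 = ennreal (1 + a + 1)" if "a \<ge> 0" for a
      using that by (simp flip: ennreal_1 ennreal_plus)
    then show ?thesis
      using monoD[OF h_mono card_unsat_le, of n ls] by simp
  qed
  also have "\<dots> \<le> ennreal (3 + 2 * h n)"
    using h_nonneg[of "card (unsat n ls)"] by (intro ennreal_leI) simp
  finally show ?thesis .
qed

text \<open>Inside a phase the potential grows by at least the expected cost of each step. At the
  end of a phase the potential and the closing move are charged to \<open>phase_count\<close>, and
  the cost of the task to \<open>reset_cost\<close>.\<close>

lemma expected_cost_le:
  "expected_cost (uniform_metric n) x0 ls (rand_run R x0 ls) \<le>
    ennreal (3 + 2 * h n) * phase_count n ls + reset_cost n ls + potential ls"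
proof (induction ls rule: rev_induct)
  case Nil
  show ?case by (simp add: expected_cost_def)
next
  case (snoc l ls)
  let ?U = "unsat n ls" and ?U' = "unsat n (ls @ [l])" and ?K = "ennreal (3 + 2 * h n)"
  let ?E = "\<lambda>ls. expected_cost (uniform_metric n) x0 ls (rand_run R x0 ls)"
  let ?d = "\<lambda>x y. ennreal (mdist (uniform_metric n) x y)"
  define G where "G = (\<integral>\<^sup>+xs. \<integral>\<^sup>+x. ?d (last (x0 # xs)) x + l x
      \<partial>R x0 (ls @ [l]) xs \<partial>rand_run R x0 ls)"
  have E: "?E (ls @ [l]) = ?E ls + G"
    unfolding G_def by (rule expected_cost_snoc) simp
  have d: "?d x y \<le> 1" for x y
    by simp
  consider (reset) "?U' = {}" | (start) "?U' \<noteq> {}" "?U = {}" | (move) "?U' \<noteq> {}" "?U \<noteq> {}"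
    by blast
  then show ?case
  proof cases
    case reset
    have "G = (\<integral>\<^sup>+xs. ?d (last (x0 # xs)) (cheapest n l) + l (cheapest n l) \<partial>rand_run R x0 ls)"
      unfolding G_def by (simp only: R_reset[OF reset] nn_integral_return_pmf zero_le)
    also have "\<dots> \<le> (\<integral>\<^sup>+xs. 1 + l (cheapest n l) \<partial>rand_run R x0 ls)"
      by (intro nn_integral_mono add_right_mono d)
    finally have "G \<le> 1 + l (cheapest n l)"
      by simp
    then have "?E (ls @ [l]) \<le>
        (?K * phase_count n ls + reset_cost n ls + potential ls) + (1 + l (cheapest n l))"
      unfolding E using snoc.IH by (rule add_mono[rotated])
    also have "\<dots> =
        ?K * phase_count n ls + reset_cost n ls + (potential ls + 1) + l (cheapest n l)"
      by (simp add: ac_simps)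
    also have "\<dots> \<le> ?K * phase_count n ls + reset_cost n ls + ?K + l (cheapest n l)"
      by (intro add_mono potential_le order_refl)
    finally show ?thesis
      using reset by (simp add: phase_count_snoc reset_cost_snoc potential_def distrib_left distrib_right ac_simps)
  next
    case start
    have "G = (\<integral>\<^sup>+xs. \<integral>\<^sup>+x. ?d (last (x0 # xs)) x + l x \<partial>D ?U' \<partial>rand_run R x0 ls)"
      unfolding G_def by (simp only: R_start[OF start])
    also have "\<dots> \<le> (\<integral>\<^sup>+xs. \<integral>\<^sup>+x. 1 + l x \<partial>D ?U' \<partial>rand_run R x0 ls)"
      by (intro nn_integral_mono add_right_mono d)
    also have "\<dots> = 1 + (\<integral>\<^sup>+x. l x \<partial>D ?U')"
      by (simp add: nn_integral_add)
    also have "\<dots> \<le> potential (ls @ [l])"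
    proof -
      have "1 \<le> ennreal (1 + 2 * (h n - h (card ?U')))"
        using ennreal_leI[of 1 "1 + 2 * (h n - h (card ?U'))"] monoD[OF h_mono card_unsat_le, of n "ls @ [l]"]
        by simp
      moreover have "counters n (ls @ [l]) = l"
        using start by (simp add: fun_eq_iff counters_snoc)
      ultimately show ?thesis
        using start by (subst add.commute) (simp only: potential_def if_False add_left_mono)
    qed
    finally have "?E (ls @ [l]) \<le>
        ?K * phase_count n ls + reset_cost n ls + potential ls + potential (ls @ [l])"
      unfolding E using snoc.IH by (rule add_mono[rotated])
    then show ?thesis
      using start by (simp add: phase_count_snoc reset_cost_snoc potential_def)
  next
    case move
    let ?J = "\<lambda>x. if x \<in> ?U' then return_pmf x else D ?U'"
    define p where "p = measure_pmf.prob (D ?U) (- ?U')"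
    have p: "0 \<le> p" "p \<le> h (card ?U) - h (card ?U')"
      unfolding p_def
      by (rule measure_nonneg, rule D_leave[OF move(1) unsat_snoc_subset[OF move(2)] unsat_subset])
    have refine: "D ?U \<bind> ?J = D ?U'"
      using move by (intro D_refine unsat_snoc_subset unsat_subset)
    have int_p: "(\<integral>\<^sup>+x. indicator (- ?U') x \<partial>D ?U) = ennreal p"
      by (simp add: p_def measure_pmf.emeasure_eq_measure)
    have int_J: "(\<integral>\<^sup>+x. \<integral>\<^sup>+y. f y \<partial>?J x \<partial>D ?U) = (\<integral>\<^sup>+x. f x \<partial>D ?U')" for f
      by (subst refine[symmetric]) simp
    \<comment> \<open>A step costs the task at the new state, and at most 1 more if the old state is
      now saturated.\<close>
    have "G \<le> (\<integral>\<^sup>+xs. (\<lambda>x. indicator (- ?U') x + (\<integral>\<^sup>+y. l y \<partial>?J x)) (last (x0 # xs))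
        \<partial>rand_run R x0 ls)"
      unfolding G_def
    proof (intro nn_integral_mono_AE AE_pmfI)
      fix xs assume "xs \<in> set_pmf (rand_run R x0 ls)"
      then have "last (x0 # xs) \<in> set_pmf (D ?U)"
        unfolding law_last[OF move(2), symmetric, of x0] by auto
      then have R: "R x0 (ls @ [l]) xs = ?J (last (x0 # xs))"
        by (rule R_move[OF move])
      have le: "(\<integral>\<^sup>+y. ?d x y + l y \<partial>?J x) \<le> indicator (- ?U') x + (\<integral>\<^sup>+y. l y \<partial>?J x)" for x
      proof (cases "x \<in> ?U'")
        case False
        have "(\<integral>\<^sup>+y. ?d x y + l y \<partial>D ?U') \<le> (\<integral>\<^sup>+y. 1 + l y \<partial>D ?U')"
          by (intro nn_integral_mono add_right_mono d)
        then show ?thesis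
          using False by (simp add: nn_integral_add)
      qed simp
      show "(\<integral>\<^sup>+y. ?d (last (x0 # xs)) y + l y \<partial>R x0 (ls @ [l]) xs) \<le>
          (\<lambda>x. indicator (- ?U') x + (\<integral>\<^sup>+y. l y \<partial>?J x)) (last (x0 # xs))"
        unfolding R by (rule le)
    qed
    also have "\<dots> = (\<integral>\<^sup>+x. indicator (- ?U') x + (\<integral>\<^sup>+y. l y \<partial>?J x) \<partial>D ?U)"
      unfolding law_last[OF move(2), symmetric, of x0] nn_integral_map_pmf ..
    also have "\<dots> = ennreal p + (\<integral>\<^sup>+x. l x \<partial>D ?U')"
      by (subst nn_integral_add) (simp_all only: int_p int_J, auto)
    finally have G: "G \<le> ennreal p + (\<integral>\<^sup>+x. l x \<partial>D ?U')" .
    \<comment> \<open>Passing from \<open>D ?U\<close> to \<open>D ?U'\<close> lowers the expected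
      counter by at most \<open>p\<close>: the abandoned states have probability \<open>p\<close>
      and counters of at most 1.\<close>
    have "(\<integral>\<^sup>+x. counters n ls x \<partial>D ?U) \<le>
        (\<integral>\<^sup>+x. indicator (- ?U') x + (\<integral>\<^sup>+y. counters n ls y \<partial>?J x) \<partial>D ?U)"
    proof (intro nn_integral_mono_AE AE_pmfI)
      fix x assume "x \<in> set_pmf (D ?U)"
      then have "counters n ls x \<le> 1"
        using D_subset[OF move(2) unsat_subset] by (auto simp: unsat_def)
      then show "counters n ls x \<le> indicator (- ?U') x + (\<integral>\<^sup>+y. counters n ls y \<partial>?J x)"
        by (cases "x \<in> ?U'") (auto intro: add_increasing2)
    qed
    also have "\<dots> = ennreal p + (\<integral>\<^sup>+x. counters n ls x \<partial>D ?U')"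
      by (subst nn_integral_add) (simp_all only: int_p int_J, auto)
    finally have c: "(\<integral>\<^sup>+x. counters n ls x \<partial>D ?U) \<le> \<dots>" .
    have hn: "h (card ?U) \<le> h n"
      by (rule monoD[OF h_mono card_unsat_le])
    \<comment> \<open>The two terms \<open>p\<close>, for the move and for the lost counter, fit
      into the increase \<open>2 * (h (card ?U) - h (card ?U'))\<close> of the last summand of the
      potential.\<close>
    have "potential ls + G \<le>
        (ennreal p + (\<integral>\<^sup>+x. counters n ls x \<partial>D ?U')) + ennreal (1 + 2 * (h n - h (card ?U)))
          + (ennreal p + (\<integral>\<^sup>+x. l x \<partial>D ?U'))"
      unfolding potential_def if_not_P[OF move(2)] by (intro add_mono c G order_refl)
    also have "\<dots> = (\<integral>\<^sup>+x. counters n ls x + l x \<partial>D ?U') +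
        (ennreal p + ennreal p + ennreal (1 + 2 * (h n - h (card ?U))))"
      by (simp add: nn_integral_add ac_simps)
    also have "ennreal p + ennreal p + ennreal (1 + 2 * (h n - h (card ?U))) =
        ennreal (p + p + (1 + 2 * (h n - h (card ?U))))"
      using p hn by (simp only: ennreal_plus[symmetric] add_nonneg_nonneg diff_ge_0_iff_ge
        mult_nonneg_nonneg zero_le_one zero_le_numeral)
    also have "(\<integral>\<^sup>+x. counters n ls x + l x \<partial>D ?U') + \<dots> \<le> potential (ls @ [l])"
    proof -
      have "counters n (ls @ [l]) = (\<lambda>x. counters n ls x + l x)"
        using move by (simp add: fun_eq_iff counters_snoc)
      moreover have "ennreal (p + p + (1 + 2 * (h n - h (card ?U)))) \<le>
          ennreal (1 + 2 * (h n - h (card ?U')))"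
        using p by (intro ennreal_leI) simp
      ultimately show ?thesis
        using move by (simp only: potential_def if_False add_left_mono)
    qed
    finally have "potential ls + G \<le> potential (ls @ [l])" .
    then have "?K * phase_count n ls + reset_cost n ls + (potential ls + G) \<le>
        ?K * phase_count n (ls @ [l]) + reset_cost n (ls @ [l]) + potential (ls @ [l])"
      using move by (simp add: phase_count_snoc reset_cost_snoc add_left_mono)
    moreover have "?E (ls @ [l]) \<le> ?K * phase_count n ls + reset_cost n ls + (potential ls + G)"
      unfolding E using add_right_mono[OF snoc.IH, of G] by (simp add: add.assoc)
    ultimately show ?thesis
      by (rule order_trans[rotated])
  qed
qed

text \<open>Both \<open>phase_count\<close> and \<open>reset_cost\<close> are at most the offline
  cost, which gives the factor \<open>(3 + 2 * h n) + 1\<close>; the potential of the unfinished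
  phase goes into the additive constant.\<close>

lemma rand_ratio_le: "rand_ratio (uniform_metric n) R \<le> ennreal (4 + 2 * h n)"
  unfolding rand_ratio_def competitive_ratio_def
proof (rule Inf_lower, safe, intro exI[of _ "3 + 2 * h n"] ballI, safe)
  fix x0 ls
  let ?K = "ennreal (3 + 2 * h n)" and ?opt = "opt_cost (uniform_metric n) x0 ls"
  have "phase_count n ls \<le> ?opt"
    unfolding opt_cost_def
  proof (rule INF_greatest)
    fix xs assume "xs \<in> schedules (uniform_metric n) (length ls)"
    then show "phase_count n ls \<le> mts_cost (uniform_metric n) x0 ls xs"
      using phase_count_le_cost[of xs ls n x0] by (auto simp: schedules_def elim: order_trans[rotated])
  qed
  moreover have "reset_cost n ls \<le> ?opt"
    unfolding opt_cost_def by (rule INF_greatest) (auto simp: schedules_def intro!: reset_cost_le_cost)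
  moreover have "potential ls \<le> ?K"
    using potential_le[of ls] by (rule order_trans[rotated]) simp
  ultimately have "?K * phase_count n ls + reset_cost n ls + potential ls \<le> ?K * ?opt + ?opt + ?K"
    by (intro add_mono mult_left_mono) auto
  also have "?K * ?opt + ?opt = (?K + 1) * ?opt"
    by (simp add: distrib_right)
  also have "?K + 1 = ennreal (4 + 2 * h n)"
    using h_nonneg[of n] by (simp flip: ennreal_1 ennreal_plus)
  finally show "expected_cost (uniform_metric n) x0 ls (rand_run R x0 ls) \<le>
      ennreal (4 + 2 * h n) * ?opt + ?K"
    using expected_cost_le[of x0 ls] by (rule order_trans[rotated])
qed

end


section \<open>Optimal ratios without predictions\<close>

text \<open>During a phase the algorithm occupies the least unsaturated state, a function of the
  tasks alone, as \<open>det_alg\<close> demands. With \<open>h = real\<close>,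
  \<open>D_leave\<close> holds because losing the minimum shrinks the set.\<close>

lemma det_opt_ratio_le:
  assumes n: "n \<ge> 1"
  shows "det_opt_ratio (uniform_metric n) \<le> ennreal (4 + 2 * n)"
proof -
  define A :: "(nat, nat task) det_alg" where
    "A = (\<lambda>x0 ls. if unsat n ls = {} then cheapest n (last ls) else Min (unsat n ls))"
  have Min_D: "Min U' = Min U" if "Min U \<in> U'" "U' \<subseteq> U" "finite U" for U U' :: "nat set"
    using that by (metis Min_antimono Min_le empty_iff finite_subset order_antisym)
  interpret phase_algorithm n "\<lambda>U. return_pmf (Min U)" real "rand_of_det A"
  proof unfold_locales
    fix U U' :: "nat set" assume U: "U' \<noteq> {}" "U' \<subseteq> U" "U \<subseteq> {..<n}"
    then have fin: "finite U"
      using finite_subset by blast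
    show "return_pmf (Min U) \<bind> (\<lambda>x. if x \<in> U' then return_pmf x else return_pmf (Min U')) =
        return_pmf (Min U')"
      using Min_D[OF _ U(2) fin] by (auto simp: bind_return_pmf)
    show "measure_pmf.prob (return_pmf (Min U)) (- U') \<le> real (card U) - real (card U')"
    proof (cases "Min U \<in> U'")
      case True
      then show ?thesis
        using card_mono[OF fin U(2)] by (simp add: measure_return_pmf)
    next
      case False
      moreover have "Min U \<in> U"
        using fin U by (intro Min_in) auto
      ultimately have "card U' < card U"
        using fin U(2) by (intro psubset_card_mono) auto
      then show ?thesis
        using False by (simp add: measure_return_pmf)
    qed
  next
    fix U :: "nat set" assume "U \<noteq> {}" "U \<subseteq> {..<n}"
    then show "set_pmf (return_pmf (Min U)) \<subseteq> U"
      using Min_in[OF finite_subset[OF _ finite_lessThan]] by simp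
  next
    fix x0 :: nat and ls and l :: "nat task" and xs :: "nat list"
    assume "unsat n (ls @ [l]) \<noteq> {}" "unsat n ls \<noteq> {}"
      "last (x0 # xs) \<in> set_pmf (return_pmf (Min (unsat n ls)))"
    then show "rand_of_det A x0 (ls @ [l]) xs = (if last (x0 # xs) \<in> unsat n (ls @ [l])
        then return_pmf (last (x0 # xs)) else return_pmf (Min (unsat n (ls @ [l]))))"
      using Min_D[OF _ unsat_snoc_subset finite_unsat, of n ls l] by (auto simp: A_def rand_of_det_def)
  qed (use n in \<open>auto simp: A_def rand_of_det_def mono_def\<close>)
  have "Min (unsat n ls) < n" if "unsat n ls \<noteq> {}" for ls
    using Min_in[OF finite_unsat that] unsat_subset[of n ls] by auto
  then have "A \<in> det_algs (uniform_metric n)"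
    using cheapest_less[OF n] by (simp add: det_algs_def A_def)
  then show ?thesis
    using rand_ratio_le unfolding det_opt_ratio_def
    by (intro INF_lower2[of A]) (auto simp: det_ratio_eq_rand_ratio)
qed

text \<open>The right side is a sum of \<open>b - a\<close> reciprocals, each at least
  \<open>1 / b\<close>.\<close>

lemma harm_diff_ge:
  assumes "a \<le> b"
  shows "(real b - real a) / real b \<le> harm b - harm a"
  using assms
proof (induction b rule: dec_induct)
  case (step b)
  have "(real (Suc b) - real a) / real (Suc b) = (real b - real a) / real (Suc b) + 1 / real (Suc b)"
    by (simp add: add_divide_distrib[symmetric])
  also have "(real b - real a) / real (Suc b) \<le> (real b - real a) / real b"
    using step.hyps by (cases "b = 0") (auto intro!: divide_left_mono)
  finally show ?case
    using step.IH by (simp add: harm_Suc divide_inverse)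
qed simp

text \<open>Conditioned on lying in \<open>U'\<close>, a uniform point of \<open>U\<close> is
  uniform on \<open>U'\<close>; otherwise it is redrawn uniformly from \<open>U'\<close>. Both cases
  have the same law.\<close>

lemma pmf_of_set_resample:
  assumes U: "U' \<noteq> {}" "U' \<subseteq> U" "finite U"
  shows "pmf_of_set U \<bind> (\<lambda>x. if x \<in> U' then return_pmf x else pmf_of_set U') = pmf_of_set U'"
proof (rule pmf_eqI)
  fix y
  have ne: "U \<noteq> {}" and fin: "finite U'"
    using U finite_subset by auto
  have pos: "card U' > 0" "card U > 0"
    using U ne fin by (auto simp: card_gt_0_iff)
  have "pmf (pmf_of_set U \<bind> (\<lambda>x. if x \<in> U' then return_pmf x else pmf_of_set U')) y =
      (\<Sum>x\<in>U. pmf (if x \<in> U' then return_pmf x else pmf_of_set U') y) / card U"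
    using U ne by (simp add: pmf_bind_pmf_of_set)
  also have "(\<Sum>x\<in>U. pmf (if x \<in> U' then return_pmf x else pmf_of_set U') y) =
      (\<Sum>x\<in>U'. pmf (return_pmf x) y) + (\<Sum>x\<in>U - U'. pmf (pmf_of_set U') y)"
    using sum.subset_diff[OF U(2,3), of "\<lambda>x. pmf (if x \<in> U' then return_pmf x else pmf_of_set U') y"]
    by (simp add: add.commute)
  also have "(\<Sum>x\<in>U'. pmf (return_pmf x) y) = indicator U' y"
    using fin by (auto simp: indicator_def of_bool_def)
  also have "(\<Sum>x\<in>U - U'. pmf (pmf_of_set U') y) =
      (real (card U) - real (card U')) * (indicator U' y / card U')"
    using U fin by (simp add: card_Diff_subset card_mono of_nat_diff)
  also have "(indicator U' y + (real (card U) - real (card U')) * (indicator U' y / card U')) / card U =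
      pmf (pmf_of_set U') y"
    using U fin pos by (auto simp: field_simps indicator_def)
  finally show "pmf (pmf_of_set U \<bind> (\<lambda>x. if x \<in> U' then return_pmf x else pmf_of_set U')) y =
      pmf (pmf_of_set U') y" .
qed

lemma rand_opt_ratio_le:
  assumes n: "n \<ge> 1"
  shows "rand_opt_ratio (uniform_metric n) \<le> ennreal (4 + 2 * harm n)"
proof -
  \<comment> \<open>\<open>butlast ls\<close> is the task list one step earlier. At the start of a
    phase the state is redrawn even if it is unsaturated, because its law need not be
    uniform.\<close>
  define R :: "(nat, nat task) rand_alg" where
    "R = (\<lambda>x0 ls xs. if unsat n ls = {} then return_pmf (cheapest n (last ls))
       else if unsat n (butlast ls) \<noteq> {} \<and> last (x0 # xs) \<in> unsat n ls
       then return_pmf (last (x0 # xs)) else pmf_of_set (unsat n ls))"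
  interpret phase_algorithm n pmf_of_set harm R
  proof unfold_locales
    fix U U' :: "nat set" assume U: "U' \<noteq> {}" "U' \<subseteq> U" "U \<subseteq> {..<n}"
    then have fin: "finite U"
      using finite_subset by blast
    show "pmf_of_set U \<bind> (\<lambda>x. if x \<in> U' then return_pmf x else pmf_of_set U') = pmf_of_set U'"
      by (rule pmf_of_set_resample[OF U(1,2) fin])
    have "U \<inter> - U' = U - U'" "U \<noteq> {}" "finite U'"
      using U fin finite_subset by auto
    then have "measure_pmf.prob (pmf_of_set U) (- U') = (real (card U) - real (card U')) / card U"
      using U fin by (simp add: measure_pmf_of_set card_Diff_subset card_mono of_nat_diff)
    also have "\<dots> \<le> harm (card U) - harm (card U')"
      by (rule harm_diff_ge) (rule card_mono[OF fin U(2)])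
    finally show "measure_pmf.prob (pmf_of_set U) (- U') \<le> harm (card U) - harm (card U')" .
  next
    fix U :: "nat set" assume "U \<noteq> {}" "U \<subseteq> {..<n}"
    then show "set_pmf (pmf_of_set U) \<subseteq> U"
      using finite_subset by (subst set_pmf_of_set) auto
  qed (use n in \<open>auto simp: R_def mono_def intro: harm_mono harm_nonneg\<close>)
  have "R \<in> rand_algs (uniform_metric n)"
    using n cheapest_less[OF n] unsat_subset[of n] by (fastforce simp: rand_algs_def R_def)
  then show ?thesis
    using rand_ratio_le unfolding rand_opt_ratio_def by (intro INF_lower2[of R]) auto
qed


section \<open>Lower bounds with predictions\<close>

text \<open>The alive set shrinks from \<open>k + 1\<close> points to 1, and the old survivor takes
  one more point, whence \<open>k + 2 \<le> n\<close>. The position is avoided with certainty;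
  \<open>1/2\<close> gives the bound the form shared with the randomized case.\<close>

lemma rand_pred_ratio_det_ge:
  assumes k: "k \<ge> 1" "k + 2 \<le> n" "real k \<le> \<eta>"
  shows "ennreal (real k / 2) \<le> rand_pred_ratio (uniform_metric n) \<eta> (rand_of_det A)"
proof -
  interpret adversary n "rand_of_det A" 0 Suc "1/2"
  proof unfold_locales
    fix "is" k and S :: "nat set" assume S: "card S = Suc (Suc k)"
    define q where "q = last (0 # det_run A 0 is)"
    have "Suc k \<le> card (S - {q})"
      using S by (simp add: card_Diff_singleton_if)
    then obtain S' where S': "S' \<subseteq> S - {q}" "card S' = Suc k"
      by (meson obtain_subset_with_card_n)
    then have "last (0 # det_run A 0 is) \<notin> S'"
      by (auto simp only: q_def)
    then have "measure_pmf.prob (rand_run (rand_of_det A) 0 is) {xs. last (0 # xs) \<notin> S'} = 1"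
      by (simp add: rand_run_rand_of_det measure_return_pmf del: last.simps)
    then show "\<exists>S'\<subseteq>S. card S' = Suc k \<and>
        1/2 \<le> measure_pmf.prob (rand_run (rand_of_det A) 0 is) {xs. last (0 # xs) \<notin> S'}"
      using S' by (intro exI[of _ S']) auto
  qed (use k in auto)
  show ?thesis
    using rand_pred_ratio_ge[of k \<eta>] k by simp
qed

text \<open>The alive set is cut into two disjoint halves. The position always misses at least one
  of them, so some half is missed with probability at least 1/2, and it is kept.\<close>

lemma rand_pred_ratio_rand_ge:
  assumes k: "k \<ge> 1" "2 ^ k < n" "real k \<le> \<eta>"
  shows "ennreal (real k / 2) \<le> rand_pred_ratio (uniform_metric n) \<eta> R"
proof -
  interpret adversary n R 0 "\<lambda>k. 2 ^ k" "1/2"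
  proof unfold_locales
    fix "is" k and S :: "nat set" assume S: "card S = 2 ^ Suc k"
    define P where "P = rand_run R 0 is"
    let ?p = "\<lambda>S'. measure_pmf.prob P {xs. last (0 # xs) \<notin> S'}"
    have fin: "finite S"
      using S by (intro card_ge_0_finite) simp
    have "(2::nat) ^ k \<le> card S"
      using S by simp
    then obtain S1 where S1: "S1 \<subseteq> S" "card S1 = 2 ^ k"
      by (meson obtain_subset_with_card_n)
    have S2: "card (S - S1) = 2 ^ k"
      using S S1 fin finite_subset by (subst card_Diff_subset) auto
    have "1 = measure_pmf.prob P ({xs. last (0 # xs) \<notin> S1} \<union> {xs. last (0 # xs) \<notin> S - S1})"
      by (rule sym, rule measure_pmf.prob_eq_1[THEN iffD2]) auto
    also have "\<dots> \<le> ?p S1 + ?p (S - S1)"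
      by (rule measure_subadditive) auto
    finally have "1/2 \<le> ?p S1 \<or> 1/2 \<le> ?p (S - S1)"
      by linarith
    then show "\<exists>S'\<subseteq>S. card S' = 2 ^ k \<and> 1/2 \<le> measure_pmf.prob P {xs. last (0 # xs) \<notin> S'}"
      using S1 S2 by (meson Diff_subset)
  qed (use k in auto)
  show ?thesis
    using rand_pred_ratio_ge[of k \<eta>] k by simp
qed

text \<open>This serves the cases in which no phase is affordable, such as
  \<open>\<eta> < 1\<close>. A single task of constant cost \<open>K\<close> is paid by every
  schedule, and a large \<open>K\<close> outweighs the additive constant.\<close>

lemma rand_pred_ratio_ge_1:
  assumes n: "n \<ge> 1"
  shows "1 \<le> rand_pred_ratio (uniform_metric n) \<eta> R"
  unfolding rand_pred_ratio_def competitive_ratio_def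
proof (rule Inf_greatest, safe)
  fix r c
  assume *: "\<forall>i\<in>pred_instances (uniform_metric n) \<eta>.
    (case i of (x0, ls, ps) \<Rightarrow> expected_cost (uniform_metric n) x0 ls (rand_run R x0 (zip ls ps)))
    \<le> r * (case i of (x0, ls, ps) \<Rightarrow> opt_cost (uniform_metric n) x0 ls) + ennreal c"
  have bound: "ennreal K \<le> r * ennreal K + ennreal c" for K
  proof -
    let ?ls = "[\<lambda>_. ennreal K] :: nat task list"
    have ge: "ennreal K \<le> mts_cost (uniform_metric n) 0 ?ls xs" for xs
      by (simp add: mts_cost_def add_increasing)
    have opt: "opt_cost (uniform_metric n) 0 ?ls = ennreal K"
      unfolding opt_cost_def
    proof (rule antisym)
      show "(INF xs\<in>schedules (uniform_metric n) (length ?ls). mts_cost (uniform_metric n) 0 ?ls xs)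
          \<le> ennreal K"
        using n by (intro INF_lower2[of "[0]"]) (auto simp: schedules_def)
    qed (use ge in \<open>auto intro: INF_greatest\<close>)
    have "[0] \<in> optimal_schedules (uniform_metric n) 0 ?ls"
      using n opt by (auto simp: optimal_schedules_def schedules_def)
    then have "(0, ?ls, [0]) \<in> pred_instances (uniform_metric n) \<eta>"
      using n by (auto simp: pred_instances_def prediction_error_def schedules_def intro!: bexI[of _ "[0]"])
    then have "expected_cost (uniform_metric n) 0 ?ls (rand_run R 0 (zip ?ls [0])) \<le> r * ennreal K + ennreal c"
      using * opt by fastforce
    moreover have "(\<integral>\<^sup>+xs. ennreal K \<partial>rand_run R 0 (zip ?ls [0])) \<le>
        expected_cost (uniform_metric n) 0 ?ls (rand_run R 0 (zip ?ls [0]))"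
      unfolding expected_cost_def by (rule nn_integral_mono) (rule ge)
    ultimately show ?thesis
      by simp
  qed
  show "1 \<le> r"
  proof (cases r)
    case (real q)
    have "q \<ge> 1"
    proof (rule ccontr)
      assume q: "\<not> q \<ge> 1"
      \<comment> \<open>Chosen so that \<open>(1 - q) * K\<close> exceeds the additive constant by
        1.\<close>
      define K where "K = (max c 0 + 1) / (1 - q)"
      have K: "K \<ge> 0" "(1 - q) * K = max c 0 + 1"
        using q by (auto simp: K_def)
      have "ennreal K \<le> r * ennreal K + ennreal (max c 0)"
        using bound[of K] by (rule order_trans) (auto intro!: add_left_mono ennreal_leI)
      also have "\<dots> = ennreal (q * K + max c 0)"
        using real K by (simp add: ennreal_mult)
      finally have "K \<le> q * K + max c 0"
        using real K by (subst (asm) ennreal_le_iff) auto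
      then show False
        using K(2) by (simp add: algebra_simps)
    qed
    then show ?thesis
      using real by (simp flip: ennreal_1)
  qed simp
qed

text \<open>Phases of length up to \<open>L\<close> fit into the metric, and those of length up to
  \<open>\<eta>\<close> respect the error bound. The longest phase satisfying both is within a
  constant factor of the minimum.\<close>

lemma min_ratio_le:
  fixes \<alpha> p :: ennreal
  assumes \<eta>: "\<eta> \<ge> 0" and \<alpha>: "\<alpha> \<le> ennreal (10 * max 1 (real L))" and p: "1 \<le> p"
    and ge: "\<And>k. \<lbrakk>k \<ge> 1; k \<le> L; real k \<le> \<eta>\<rbrakk> \<Longrightarrow> ennreal (real k / 2) \<le> p"
  shows "ennreal (1/20) * min \<alpha> (ennreal (1 + \<eta>)) \<le> p"
proof -
  define k where "k = min L (nat \<lfloor>\<eta>\<rfloor>)"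
  have k: "ennreal (max 1 (real k / 2)) \<le> p"
  proof (cases "k \<ge> 1")
    case True
    then have "ennreal (real k / 2) \<le> p"
      using \<eta> by (intro ge) (auto simp: k_def min_def split: if_splits; linarith)+
    then show ?thesis
      using p by (simp add: max_def)
  qed (use p in auto)
  \<comment> \<open>If \<open>k = L\<close>, the first term of the minimum suffices; otherwise
    \<open>k\<close> is the floor of \<open>\<eta>\<close> and
    \<open>1 + \<eta> < k + 2\<close>.\<close>
  have "min (10 * max 1 (real L)) (1 + \<eta>) \<le> 20 * max 1 (real k / 2)"
    using \<eta> unfolding k_def by (simp add: min_def max_def; linarith)
  then have "ennreal (1/20 * min (10 * max 1 (real L)) (1 + \<eta>)) \<le> ennreal (max 1 (real k / 2))"
    by (intro ennreal_leI) simp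
  also have "\<dots> \<le> p"
    by (rule k)
  finally have "ennreal (1/20) * ennreal (min (10 * max 1 (real L)) (1 + \<eta>)) \<le> p"
    using \<eta> by (simp add: ennreal_mult[symmetric])
  moreover have "min \<alpha> (ennreal (1 + \<eta>)) \<le> ennreal (min (10 * max 1 (real L)) (1 + \<eta>))"
  proof -
    have "min \<alpha> (ennreal (1 + \<eta>)) \<le> min (ennreal (10 * max 1 (real L))) (ennreal (1 + \<eta>))"
      using \<alpha> by (rule min.mono) simp
    also have "\<dots> \<le> ennreal (min (10 * max 1 (real L)) (1 + \<eta>))"
      unfolding min_def[of "10 * max 1 (real L)"] by auto
    finally show ?thesis .
  qed
  ultimately show ?thesis
    by (meson mult_left_mono order_trans zero_le)
qed

text \<open>An algorithm may be run with predictions that it ignores, and \<open>\<eta> = n\<close>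
  admits phases of length \<open>n - 2\<close>.\<close>

lemma det_opt_ratio_ge:
  assumes "n \<ge> 3"
  shows "ennreal ((real n - 2) / 2) \<le> det_opt_ratio (uniform_metric n)"
  unfolding det_opt_ratio_def
proof (rule INF_greatest)
  fix A :: "(nat, nat task) det_alg"
  let ?A = "\<lambda>x is. A x (map fst is) :: nat"
  have "ennreal ((real n - 2) / 2) \<le> rand_pred_ratio (uniform_metric n) n (rand_of_det ?A)"
    using rand_pred_ratio_det_ge[of "n - 2" n "real n" ?A] assms by (simp add: of_nat_diff)
  also have "rand_of_det ?A = (\<lambda>x is. rand_of_det A x (map fst is))"
    by (simp add: rand_of_det_def fun_eq_iff)
  also have "rand_pred_ratio (uniform_metric n) n \<dots> \<le> det_ratio (uniform_metric n) A"
    unfolding det_ratio_eq_rand_ratio by (rule rand_pred_ratio_ignore_le)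
  finally show "ennreal ((real n - 2) / 2) \<le> det_ratio (uniform_metric n) A" .
qed

lemma rand_opt_ratio_ge:
  assumes "k \<ge> 1" "2 ^ k < n"
  shows "ennreal (real k / 2) \<le> rand_opt_ratio (uniform_metric n)"
  unfolding rand_opt_ratio_def
proof (rule INF_greatest)
  fix R :: "(nat, nat task) rand_alg"
  have "ennreal (real k / 2) \<le> rand_pred_ratio (uniform_metric n) k (\<lambda>x is. R x (map fst is))"
    using rand_pred_ratio_rand_ge[OF assms, of k] by simp
  also have "\<dots> \<le> rand_ratio (uniform_metric n) R"
    by (rule rand_pred_ratio_ignore_le)
  finally show "ennreal (real k / 2) \<le> rand_ratio (uniform_metric n) R" .
qed

section \<open>Order of growth of the optimal ratios\<close>

lemma enn2real_bounds:
  assumes "ennreal a \<le> x" "x \<le> ennreal b" "0 \<le> a" "0 \<le> b"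
  shows "a \<le> enn2real x" "enn2real x \<le> b"
proof -
  \<comment> \<open>At infinity \<open>enn2real\<close> would return 0, so the lower bound rests on
    finiteness.\<close>
  have "x < top"
    using assms(2) by (rule le_less_trans) simp
  then show "a \<le> enn2real x"
    using enn2real_mono[OF assms(1)] assms(3) by simp
  show "enn2real x \<le> b"
    using enn2real_leI[OF assms(4,2)] .
qed

lemma harm_le_ln: "n \<ge> 1 \<Longrightarrow> harm n \<le> 1 + ln (real n)"
  using decseqD[OF decseq_harm_diff_ln, of 0 "n - 1"] by (simp add: harm_def)

text \<open>For \<open>n \<ge> 3\<close>, \<open>L\<close> is the largest exponent with
  \<open>2 ^ L < n\<close>, and \<open>4 + 2 * harm n \<le> 6 + 2 * ln n \<le> 8 + 2 * L \<le> 10 *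
  L\<close>. For smaller \<open>n\<close> it is 0.\<close>

lemma dyadic_scale:
  assumes n: "n \<ge> 1"
  obtains L :: nat where "4 + 2 * harm n \<le> 10 * max 1 (real L)" "ln (real n) \<le> real L + 1"
    "n \<ge> 3 \<Longrightarrow> L \<ge> 1" "\<And>k. \<lbrakk>k \<ge> 1; k \<le> L\<rbrakk> \<Longrightarrow> 2 ^ k < n"
proof (cases "n \<ge> 3")
  case True
  then obtain L where L: "2 ^ L < n" "n \<le> 2 ^ (L + 1)"
    using ex_power_ivl2[of 2 n] by auto
  have L_pos: "L \<ge> 1"
    using True L by (cases L) auto
  have "ln (real n) \<le> ln (2 ^ (L + 1))"
  proof (subst ln_le_cancel_iff)
    show "real n \<le> 2 ^ (L + 1)"
      using L(2) by (metis of_nat_le_iff of_nat_numeral of_nat_power)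
    show "0 < real n"
      using n by simp
  qed simp
  also have "\<dots> = real (L + 1) * ln 2"
    by (rule ln_realpow)
  also have "\<dots> \<le> real (L + 1) * 1"
    using ln_le_minus_one[of 2] by (intro mult_left_mono) auto
  finally have ln: "ln (real n) \<le> real L + 1"
    by simp
  show ?thesis
  proof (rule that)
    show "4 + 2 * harm n \<le> 10 * max 1 (real L)"
      using harm_le_ln[OF n] ln L_pos by (simp add: max_def)
    show "2 ^ k < n" if "k \<le> L" for k
      by (rule le_less_trans[OF power_increasing[OF that] L(1)]) simp
  qed (use ln L_pos in auto)
next
  case False
  then have "n = 1 \<or> n = 2"
    using n by auto
  then show ?thesis
    using ln_le_minus_one[of 2] harm_le_ln[OF n] by (intro that[of 0]) auto
qed

lemma det_alpha_bigtheta: "det_alpha \<in> \<Theta>(\<lambda>n. real n)"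
proof (rule bigthetaI)
  \<comment> \<open>From \<open>n = 4\<close> on, \<open>(n - 2) / 2 \<ge> n / 4\<close> and
    \<open>4 + 2 * n \<le> 3 * n\<close>, which gives the constants below.\<close>
  have bounds: "(real n - 2) / 2 \<le> det_alpha n" "det_alpha n \<le> 4 + 2 * real n" if "n \<ge> 4" for n
    using enn2real_bounds[OF det_opt_ratio_ge det_opt_ratio_le, of n] that
    by (auto simp: det_alpha_def)
  show "det_alpha \<in> O(\<lambda>n. real n)"
    using bounds eventually_ge_at_top[of 4]
    by (intro bigoI[of _ 3]) (fastforce elim!: eventually_mono simp: det_alpha_def)
  show "det_alpha \<in> \<Omega>(\<lambda>n. real n)"
    using bounds eventually_ge_at_top[of 4]
    by (intro landau_omega.bigI[of "1/4"]) (fastforce elim!: eventually_mono simp: det_alpha_def)+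
qed

lemma rand_alpha_bigtheta: "rand_alpha \<in> \<Theta>(\<lambda>n. ln (real n))"
proof (rule bigthetaI)
  \<comment> \<open>Once \<open>ln n \<ge> 2\<close>, \<open>6 + 2 * ln n \<le> 5 * ln n\<close> and
    \<open>(ln n - 1) / 2 \<ge> ln n / 4\<close>.\<close>
  have ev: "eventually (\<lambda>n. n \<ge> 3 \<and> exp 2 \<le> real n) sequentially"
    using eventually_ge_at_top[of 3] filterlim_real_sequentially
    by (auto simp: filterlim_at_top eventually_conj_iff)
  have bounds: "1/4 * ln (real n) \<le> rand_alpha n" "rand_alpha n \<le> 5 * ln (real n)" "0 \<le> ln (real n)"
    if n: "n \<ge> 3 \<and> exp 2 \<le> real n" for n
  proof -
    have n1: "n \<ge> 1"
      using n by simp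
    obtain L where L: "ln (real n) \<le> real L + 1" "n \<ge> 3 \<Longrightarrow> L \<ge> 1"
        "\<And>k. \<lbrakk>k \<ge> 1; k \<le> L\<rbrakk> \<Longrightarrow> 2 ^ k < n"
      using dyadic_scale[OF n1] by metis
    have "ennreal (real L / 2) \<le> rand_opt_ratio (uniform_metric n)"
      using L n by (intro rand_opt_ratio_ge) auto
    note * = enn2real_bounds[OF this rand_opt_ratio_le[OF n1]]
    have ln: "2 \<le> ln (real n)"
      using n by (subst ln_ge_iff) auto
    have "real L / 2 \<le> rand_alpha n" "rand_alpha n \<le> 4 + 2 * harm n"
      unfolding rand_alpha_def by (intro *; simp add: harm_nonneg)+
    then show "1/4 * ln (real n) \<le> rand_alpha n" "rand_alpha n \<le> 5 * ln (real n)" "0 \<le> ln (real n)"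
      using ln L(1) harm_le_ln[OF n1] by linarith+
  qed
  have nonneg: "0 \<le> rand_alpha n" for n
    by (simp add: rand_alpha_def)
  show "rand_alpha \<in> O(\<lambda>n. ln (real n))"
    using ev by (intro bigoI[of _ 5], elim eventually_mono) (use bounds nonneg in force)
  show "rand_alpha \<in> \<Omega>(\<lambda>n. ln (real n))"
  proof (rule landau_omega.bigI[of "1/4"])
    show "eventually (\<lambda>n. norm (rand_alpha n) \<ge> 1/4 * norm (ln (real n))) sequentially"
      using ev by (rule eventually_mono) (use bounds nonneg in force)
  qed simp
qed

section \<open>Lower bounds in terms of the optimal ratios\<close>

lemma det_pred_ratio_lower:
  assumes "\<eta> \<ge> 0" "n \<ge> 1"
  shows "ennreal (1/20) * min (det_opt_ratio (uniform_metric n)) (ennreal (1 + \<eta>))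
    \<le> det_pred_ratio (uniform_metric n) \<eta> A"
  unfolding det_pred_ratio_eq_rand_pred_ratio
proof (rule min_ratio_le[where L = "n - 2"])
  \<comment> \<open>For \<open>n \<le> 2\<close> the truncated difference is 0 and the left side is
    at most 8; at \<open>n = 3\<close> both sides are 10.\<close>
  have "4 + 2 * real n \<le> 10 * max 1 (real (n - 2))"
    by (cases "n \<ge> 3") (auto simp: of_nat_diff max_def)
  then show "det_opt_ratio (uniform_metric n) \<le> ennreal (10 * max 1 (real (n - 2)))"
    by (intro order_trans[OF det_opt_ratio_le[OF assms(2)]] ennreal_leI) simp
qed (use assms in \<open>auto intro!: rand_pred_ratio_ge_1 rand_pred_ratio_det_ge\<close>)

lemma rand_pred_ratio_lower:
  assumes "\<eta> \<ge> 0" "n \<ge> 1"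
  shows "ennreal (1/20) * min (rand_opt_ratio (uniform_metric n)) (ennreal (1 + \<eta>))
    \<le> rand_pred_ratio (uniform_metric n) \<eta> R"
proof -
  obtain L where L: "4 + 2 * harm n \<le> 10 * max 1 (real L)"
      "\<And>k. \<lbrakk>k \<ge> 1; k \<le> L\<rbrakk> \<Longrightarrow> 2 ^ k < n"
    using dyadic_scale[OF assms(2)] by metis
  show ?thesis
  proof (rule min_ratio_le[where L = L])
    show "rand_opt_ratio (uniform_metric n) \<le> ennreal (10 * max 1 (real L))"
      using rand_opt_ratio_le[OF assms(2)] L(1) by (meson ennreal_leI order_trans)
  qed (use assms L in \<open>auto intro!: rand_pred_ratio_ge_1 rand_pred_ratio_rand_ge\<close>)
qed

theorem theorem8:
  shows "det_alpha \<in> \<Theta>(\<lambda>n. real n) \<and>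
    (\<exists>C::real. C > 0 \<and> (\<forall>(\<eta>::real) (n::nat). \<eta> \<ge> 0 \<longrightarrow> n \<ge> 1 \<longrightarrow>
       (\<forall>A\<in>det_algs (uniform_metric n).
          ennreal C * min (det_opt_ratio (uniform_metric n)) (ennreal (1 + \<eta>))
            \<le> det_pred_ratio (uniform_metric n) \<eta> A))) \<and>
    rand_alpha \<in> \<Theta>(\<lambda>n. ln (real n)) \<and>
    (\<exists>C::real. C > 0 \<and> (\<forall>(\<eta>::real) (n::nat). \<eta> \<ge> 0 \<longrightarrow> n \<ge> 1 \<longrightarrow>
       (\<forall>R\<in>rand_algs (uniform_metric n).
          ennreal C * min (rand_opt_ratio (uniform_metric n)) (ennreal (1 + \<eta>))
            \<le> rand_pred_ratio (uniform_metric n) \<eta> R)))"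
proof (intro conjI)
  show "\<exists>C::real. C > 0 \<and> (\<forall>(\<eta>::real) (n::nat). \<eta> \<ge> 0 \<longrightarrow> n \<ge> 1 \<longrightarrow>
       (\<forall>A\<in>det_algs (uniform_metric n).
          ennreal C * min (det_opt_ratio (uniform_metric n)) (ennreal (1 + \<eta>))
            \<le> det_pred_ratio (uniform_metric n) \<eta> A))"
    using det_pred_ratio_lower by (intro exI[of _ "1/20"]) auto
  show "\<exists>C::real. C > 0 \<and> (\<forall>(\<eta>::real) (n::nat). \<eta> \<ge> 0 \<longrightarrow> n \<ge> 1 \<longrightarrow>
       (\<forall>R\<in>rand_algs (uniform_metric n).
          ennreal C * min (rand_opt_ratio (uniform_metric n)) (ennreal (1 + \<eta>))
            \<le> rand_pred_ratio (uniform_metric n) \<eta> R))"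
    using rand_pred_ratio_lower by (intro exI[of _ "1/20"]) auto
qed (rule det_alpha_bigtheta rand_alpha_bigtheta)+

end
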